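(* Let $R$ be a Noetherian integral domain, let $M=(f_{ij})$ be an $m\times n$ matrix with entries in $R$ ($1\le i\le m$, $1\le j\le n$), and let $h_i=f_{i1}T_1+\cdots+f_{in}T_n\in B:=R[T_1,\ldots,T_n]$ for $i=1,\ldots,m$. Suppose that $h_1,\ldots,h_m$ form a regular sequence in $B$. Then $n\geq m$ and $I_{\min(m,n)}\neq (0)$.
   Context: For $j\in\{1,\ldots,\min(m,n)\}$, $I_j\subseteq R$ denotes the (Fitting) ideal generated by the $j\times j$ minors of the matrix $M$. The ring $B/(h_1,\ldots,h_m)$ is called the homogeneous forcing algebra of the data $\{f_{ij}\}$. *)

theory Defs
  imports
    "HOL-Algebra.Algebra"
    "HOL-Library.Poly_Mapping"
    "Jordan_Normal_Form.DL_Rank_Submatrix"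
begin

text \<open>
  The base ring is a type \<open>'a\<close> of class \<^class>\<open>idom\<close>. The notions of ideal theory are those of
  HOL-Algebra, applied to the ring record \<open>class_ring\<close> of that type.

  A polynomial in the variables \<open>T\<^sub>0, T\<^sub>1, \<dots>\<close> is a finitely supported map from exponent vectors
  \<^typ>\<open>nat \<Rightarrow>\<^sub>0 nat\<close> to coefficients; \<open>R[T\<^sub>0, \<dots>, T\<^sub>n\<^sub>-\<^sub>1]\<close> consists of those polynomials in which
  only the variables with index less than \<open>n\<close> occur. All indices start at \<open>0\<close>.
\<close>

type_synonym 'a mpolynomial = "(nat \<Rightarrow>\<^sub>0 nat) \<Rightarrow>\<^sub>0 'a"

definition mpoly_const :: "'a::comm_ring_1 \<Rightarrow> 'a mpolynomial" where
  "mpoly_const c = Poly_Mapping.single 0 c"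

definition mpoly_var :: "nat \<Rightarrow> 'a::comm_ring_1 mpolynomial" where
  "mpoly_var i = Poly_Mapping.single (Poly_Mapping.single i 1) 1"

definition mpoly_ring :: "nat \<Rightarrow> 'a::comm_ring_1 mpolynomial ring" where
  "mpoly_ring n =
    class_ring\<lparr>carrier := {p. \<forall>t \<in> Poly_Mapping.keys p. Poly_Mapping.keys t \<subseteq> {..<n}}\<rparr>"

definition row_form :: "'a::comm_ring_1 mat \<Rightarrow> nat \<Rightarrow> 'a mpolynomial" where
  "row_form M i = (\<Sum>j<dim_col M. mpoly_const (M $$ (i, j)) * mpoly_var j)"

definition nonzerodivisor :: "('b, 'c) ring_scheme \<Rightarrow> 'b \<Rightarrow> bool" where
  "nonzerodivisor A a \<longleftrightarrow>
    a \<in> carrier A \<and> (\<forall>x \<in> carrier A. a \<otimes>\<^bsub>A\<^esub> x = \<zero>\<^bsub>A\<^esub> \<longrightarrow> x = \<zero>\<^bsub>A\<^esub>)"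

text \<open>
  The last conjunct, \<open>A/(a\<^sub>0, \<dots>, a\<^sub>k\<^sub>-\<^sub>1) \<noteq> 0\<close>, is part of the notion of a regular sequence.
\<close>

definition regular_sequence :: "('b, 'c) ring_scheme \<Rightarrow> 'b list \<Rightarrow> bool" where
  "regular_sequence A as \<longleftrightarrow>
    set as \<subseteq> carrier A \<and>
    (\<forall>i < length as.
      let I = Idl\<^bsub>A\<^esub> (set (take i as)) in nonzerodivisor (A Quot I) (I +>\<^bsub>A\<^esub> (as ! i))) \<and>
    Idl\<^bsub>A\<^esub> (set as) \<noteq> carrier A"

definition fitting_ideal :: "nat \<Rightarrow> 'a::comm_ring_1 mat \<Rightarrow> 'a set" where
  "fitting_ideal k M =
    Idl\<^bsub>class_ring\<^esub> {det (submatrix M I J) | I J.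
      I \<subseteq> {..<dim_row M} \<and> J \<subseteq> {..<dim_col M} \<and> card I = k \<and> card J = k}"

text \<open>
  \<^const>\<open>genideal\<close> is meaningful only over a ring, so it is checked here that the two records
  it is applied to are rings and that the linear forms lie in the polynomial ring.
\<close>

lemma cring_class_ring: "cring (class_ring :: 'a::comm_ring_1 ring)"
  by unfold_locales (simp_all add: mult.commute)

lemma mpoly_ring_closed:
  "mpoly_const c \<in> carrier (mpoly_ring n)"
  "i < n \<Longrightarrow> mpoly_var i \<in> carrier (mpoly_ring n)"
  "p \<in> carrier (mpoly_ring n) \<Longrightarrow> - p \<in> carrier (mpoly_ring n)"
  "p \<in> carrier (mpoly_ring n) \<Longrightarrow> q \<in> carrier (mpoly_ring n) \<Longrightarrow> p + q \<in> carrier (mpoly_ring n)"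
  "p \<in> carrier (mpoly_ring n) \<Longrightarrow> q \<in> carrier (mpoly_ring n) \<Longrightarrow> p * q \<in> carrier (mpoly_ring n)"
proof -
  show "mpoly_const c \<in> carrier (mpoly_ring n)"
    by (auto simp: mpoly_const_def mpoly_ring_def)
  show "i < n \<Longrightarrow> mpoly_var i \<in> carrier (mpoly_ring n)"
    by (auto simp: mpoly_var_def mpoly_ring_def)
  show "p \<in> carrier (mpoly_ring n) \<Longrightarrow> - p \<in> carrier (mpoly_ring n)"
    by (auto simp: mpoly_ring_def in_keys_iff)
  assume p: "p \<in> carrier (mpoly_ring n)" and q: "q \<in> carrier (mpoly_ring n)"
  show "p + q \<in> carrier (mpoly_ring n)"
    using p q Poly_Mapping.keys_add[of p q] by (fastforce simp: mpoly_ring_def)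
  show "p * q \<in> carrier (mpoly_ring n)"
  proof -
    have "Poly_Mapping.keys t \<subseteq> {..<n}" if tpq: "t \<in> Poly_Mapping.keys (p * q)" for t
    proof -
      obtain a b where t: "t = a + b" "a \<in> Poly_Mapping.keys p" "b \<in> Poly_Mapping.keys q"
        using tpq keys_mult[of p q] by blast
      have "Poly_Mapping.keys a \<subseteq> {..<n}" "Poly_Mapping.keys b \<subseteq> {..<n}"
        using p q t by (auto simp: mpoly_ring_def)
      then show ?thesis using t(1) Poly_Mapping.keys_add[of a b] by blast
    qed
    then show ?thesis by (auto simp: mpoly_ring_def)
  qed
qed

lemma cring_mpoly_ring: "cring (mpoly_ring n :: 'a::comm_ring_1 mpolynomial ring)"
proof (rule cringI)
  have [simp]: "\<zero>\<^bsub>mpoly_ring n\<^esub> = (0 :: 'a mpolynomial)" "\<one>\<^bsub>mpoly_ring n\<^esub> = (1 :: 'a mpolynomial)"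
    "x \<oplus>\<^bsub>mpoly_ring n\<^esub> y = x + y" "x \<otimes>\<^bsub>mpoly_ring n\<^esub> y = x * y" for x y :: "'a mpolynomial"
    by (auto simp: mpoly_ring_def)
  have [simp]: "(0 :: 'a mpolynomial) \<in> carrier (mpoly_ring n)"
    by (simp add: mpoly_ring_def)
  have [simp]: "(1 :: 'a mpolynomial) \<in> carrier (mpoly_ring n)"
    using mpoly_ring_closed(1)[of "1::'a" n] by (simp add: mpoly_const_def)
  show "abelian_group (mpoly_ring n :: 'a mpolynomial ring)"
    by (rule abelian_groupI)
      (auto simp: ac_simps mpoly_ring_closed intro!: bexI[of _ "- x" for x])
  show "comm_monoid (mpoly_ring n :: 'a mpolynomial ring)"
    by (rule comm_monoidI) (auto simp: ac_simps mpoly_ring_closed)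
qed (auto simp: mpoly_ring_def distrib_right)

lemma row_form_closed: "row_form M i \<in> carrier (mpoly_ring (dim_col M))"
proof -
  have "(\<Sum>j\<in>S. mpoly_const (M $$ (i, j)) * mpoly_var j) \<in> carrier (mpoly_ring (dim_col M))"
    if "finite S" "S \<subseteq> {..<dim_col M}" for S
    using that
  proof (induction S rule: finite_induct)
    case empty
    show ?case by (simp add: mpoly_ring_def)
  next
    case (insert j S)
    then show ?case by (simp add: mpoly_ring_closed)
  qed
  from this[of "{..<dim_col M}"] show ?thesis by (simp add: row_form_def)
qed

end

theory Submission
  imports Defs
begin

text \<open>
  Write \<open>h\<^sub>i\<close> for the linear form of row \<open>i\<close>. The theorem comes down to the observation that a nontrivial
  relation with constant coefficients between the \<open>h\<^sub>i\<close> contradicts regularity. Let \<open>c\<^sub>0 h\<^sub>0 + \<dots> + c\<^sub>k h\<^sub>k = 0\<close>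
  with all \<open>c\<^sub>i\<close> in the base ring. Then \<open>c\<^sub>k h\<^sub>k\<close> lies in the ideal generated by the preceding forms, and
  since \<open>h\<^sub>k\<close> is a nonzerodivisor modulo that ideal, so does \<open>c\<^sub>k\<close>. But the polynomials without
  constant term form an ideal that contains every \<open>h\<^sub>i\<close>, so the constant \<open>c\<^sub>k\<close> is \<open>0\<close>
  (\<open>rows_independent_if_regular\<close>).

  Consequently the first \<open>k + 1\<close> rows of \<open>M\<close> never satisfy a linear relation whose last coefficient is
  nonzero. This yields a nonzero maximal minor by bordering (\<open>nonzero_bordering_minor\<close>). Given \<open>r\<close>
  columns on which the first \<open>r\<close> rows have a nonzero minor, add row \<open>r\<close> and a further column \<open>j\<close>,
  and expand the larger minor along the new column. The cofactors do not depend on \<open>j\<close>, and the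
  last one is the old minor. If all these larger minors vanished, the cofactors would be a relation
  between the rows whose last coefficient is nonzero.

  After \<open>m\<close> steps there are \<open>m\<close> columns with nonzero determinant. They are distinct, so \<open>m \<le> n\<close>, and
  sorting them changes the determinant only by a sign (\<open>det_selected_columns\<close>), which gives a nonzero
  generator of the Fitting ideal.
\<close>

text \<open>
  Translates the condition on cosets in the quotient ring into a cancellation rule for ideal
  membership in the ring itself.
\<close>

lemma regular_sequence_cancel:
  assumes "cring A" "regular_sequence A as" "k < length as"
    and a: "a \<in> carrier A" and mult: "(as ! k) \<otimes>\<^bsub>A\<^esub> a \<in> Idl\<^bsub>A\<^esub> (set (take k as))"
  shows "a \<in> Idl\<^bsub>A\<^esub> (set (take k as))"
proof -
  interpret A: cring A by fact
  define I where "I = Idl\<^bsub>A\<^esub> (set (take k as))"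
  have as: "set as \<subseteq> carrier A" and "nonzerodivisor (A Quot I) (I +>\<^bsub>A\<^esub> (as ! k))"
    using assms(2,3) by (auto simp: regular_sequence_def I_def Let_def)
  then have nzd: "Y \<in> carrier (A Quot I) \<Longrightarrow>
      rcoset_mult A I (I +>\<^bsub>A\<^esub> (as ! k)) Y = I \<Longrightarrow> Y = I" for Y
    by (simp add: nonzerodivisor_def FactRing_def)
  have "set (take k as) \<subseteq> carrier A" using as set_take_subset by fastforce
  then interpret I: ideal I A unfolding I_def by (rule A.genideal_ideal)
  have ask: "as ! k \<in> carrier A" using as assms(3) nth_mem by blast
  have "I +>\<^bsub>A\<^esub> a \<in> carrier (A Quot I)"
    using a by (simp add: FactRing_def A.a_rcosetsI I.a_subset)
  moreover have "rcoset_mult A I (I +>\<^bsub>A\<^esub> (as ! k)) (I +>\<^bsub>A\<^esub> a) = I"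
    using I.rcoset_mult_add[OF ask a] A.a_rcos_zero[OF I.ideal_axioms mult[folded I_def]] by simp
  ultimately have "I +>\<^bsub>A\<^esub> a = I"
    using nzd by (force simp: FactRing_def)
  then show ?thesis
    using I.a_rcos_self[OF a] by (simp add: I_def)
qed

lemma exponent_add_eq_0_iff: "a + b = 0 \<longleftrightarrow> a = 0 \<and> b = 0" for a b :: "'b \<Rightarrow>\<^sub>0 nat"
  by (auto simp: poly_mapping_eq_iff lookup_add fun_eq_iff)

lemma mpoly_ring_simps [simp]:
  "\<zero>\<^bsub>mpoly_ring n\<^esub> = 0" "\<one>\<^bsub>mpoly_ring n\<^esub> = 1"
  "x \<oplus>\<^bsub>mpoly_ring n\<^esub> y = x + y" "x \<otimes>\<^bsub>mpoly_ring n\<^esub> y = x * y"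
  by (auto simp: mpoly_ring_def)

text \<open>
  This is the kernel of the evaluation at \<open>T = 0\<close>. It is closed under multiplication because a sum of
  exponent vectors vanishes only if both summands do.
\<close>

lemma ideal_no_constant_term:
  "ideal {p \<in> carrier (mpoly_ring n). Poly_Mapping.lookup p 0 = 0} 
     (mpoly_ring n :: 'a::comm_ring_1 mpolynomial ring)"
proof -
  interpret cring "mpoly_ring n :: 'a mpolynomial ring" by (rule cring_mpoly_ring)
  have minus: "\<ominus>\<^bsub>mpoly_ring n\<^esub> p = - p" if "p \<in> carrier (mpoly_ring n)" for p :: "'a mpolynomial"
    by (rule minus_equality) (use that in \<open>auto intro: mpoly_ring_closed\<close>)
  have mult: "Poly_Mapping.lookup (p * q) 0 = 0" if "Poly_Mapping.lookup q 0 = 0"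
    for p q :: "'a mpolynomial"
  proof (rule ccontr)
    assume "Poly_Mapping.lookup (p * q) 0 \<noteq> 0"
    then have "0 \<in> Poly_Mapping.keys (p * q)" by (simp add: in_keys_iff)
    then obtain a b where "0 = a + b" "b \<in> Poly_Mapping.keys q" using keys_mult[of p q] by blast
    then show False using that by (metis exponent_add_eq_0_iff in_keys_iff)
  qed
  show ?thesis
  proof (rule idealI)
    show "subgroup {p \<in> carrier (mpoly_ring n). Poly_Mapping.lookup p 0 = 0}
        (add_monoid (mpoly_ring n :: 'a mpolynomial ring))"
      by (rule add.subgroupI)
        (use zero_closed in \<open>auto simp: a_inv_def[symmetric] minus lookup_add mpoly_ring_closed intro!: exI[of _ 0]\<close>)
  next
    fix p x :: "'a mpolynomial"
    assume "p \<in> {p \<in> carrier (mpoly_ring n). Poly_Mapping.lookup p 0 = 0}" "x \<in> carrier (mpoly_ring n)"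
    then show "x \<otimes>\<^bsub>mpoly_ring n\<^esub> p \<in> {p \<in> carrier (mpoly_ring n). Poly_Mapping.lookup p 0 = 0}"
      "p \<otimes>\<^bsub>mpoly_ring n\<^esub> x \<in> {p \<in> carrier (mpoly_ring n). Poly_Mapping.lookup p 0 = 0}"
      using mult[of p x] by (auto simp: mpoly_ring_closed mult.commute)
  qed unfold_locales
qed

lemma mpoly_const_add: "mpoly_const (a + b) = mpoly_const a + mpoly_const b"
  by (simp add: mpoly_const_def single_add)

lemma mpoly_const_mult: "mpoly_const (a * b) = mpoly_const a * mpoly_const b"
  by (simp add: mpoly_const_def mult_single)

lemma mpoly_const_0 [simp]: "mpoly_const 0 = 0"
  by (simp add: mpoly_const_def)

lemma mpoly_const_sum: "mpoly_const (\<Sum>i\<in>S. f i) = (\<Sum>i\<in>S. mpoly_const (f i))"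
  by (induction S rule: infinite_finite_induct) (auto simp: mpoly_const_add)

text \<open>
  The coefficient of each variable in a combination of the forms is the same combination of the
  matrix entries, so relations between the rows are relations between the forms.
\<close>

lemma row_form_combination:
  "(\<Sum>i\<in>S. mpoly_const (c i) * row_form M i) =
     (\<Sum>j<dim_col M. mpoly_const (\<Sum>i\<in>S. c i * M $$ (i, j)) * mpoly_var j)"
  unfolding row_form_def mpoly_const_sum mpoly_const_mult sum_distrib_left sum_distrib_right
  by (subst sum.swap) (simp add: mult.assoc)

lemma row_form_no_constant_term: "Poly_Mapping.lookup (row_form M i) 0 = 0"
proof -
  have "Poly_Mapping.single j (1::nat) \<noteq> 0" for j :: nat
    by (metis lookup_single_eq lookup_zero zero_neq_one)
  then show ?thesis
    by (auto simp: row_form_def lookup_sum mpoly_const_def mpoly_var_def mult_single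
        lookup_single when_def intro!: sum.neutral)
qed

text \<open>
  Only the last coefficient of the relation is claimed to vanish: this is what regularity at position
  \<open>k\<close> gives directly, and applied to the last nonzero coefficient of a relation it amounts to linear
  independence of the rows.
\<close>

lemma rows_independent_if_regular:
  fixes M :: "'a::comm_ring_1 mat"
  assumes M: "M \<in> carrier_mat m n"
    and reg: "regular_sequence (mpoly_ring n) (map (row_form M) [0..<m])"
    and "k < m"
    and rel: "\<And>j. j < n \<Longrightarrow> (\<Sum>i\<le>k. c i * M $$ (i, j)) = 0"
  shows "c k = 0"
proof -
  let ?A = "mpoly_ring n :: 'a mpolynomial ring"
  let ?hs = "map (row_form M) [0..<m]"
  let ?I = "Idl\<^bsub>?A\<^esub> (set (take k ?hs))"
  let ?N = "{p \<in> carrier ?A. Poly_Mapping.lookup p 0 = 0}"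
  interpret A: cring ?A by (rule cring_mpoly_ring)
  have closed: "row_form M i \<in> carrier ?A" for i
    using row_form_closed[of M i] M by simp
  have gens: "set (take k ?hs) = row_form M ` {..<k}"
    using \<open>k < m\<close> by (auto simp: take_map)
  interpret I: ideal ?I ?A
    by (rule A.genideal_ideal) (use closed gens in auto)
  have row_in: "row_form M i \<in> ?I" if "i < k" for i
    using A.genideal_self[of "set (take k ?hs)"] closed that unfolding gens by blast
  have "(\<Sum>i\<le>k. mpoly_const (c i) * row_form M i) = 0"
    unfolding row_form_combination using rel M by simp
  then have "row_form M k * mpoly_const (c k) = (\<Sum>i<k. mpoly_const (- c i) * row_form M i)"
    by (simp add: lessThan_Suc_atMost[symmetric] mpoly_const_def single_uminus sum_negf
        add_eq_0_iff2 mult.commute)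
  moreover have "(\<Sum>i\<in>S. mpoly_const (- c i) * row_form M i) \<in> ?I" if "finite S" "S \<subseteq> {..<k}" for S
    using that
  proof (induction S rule: finite_induct)
    case empty
    show ?case using I.zero_closed by simp
  next
    case (insert i S)
    then have "mpoly_const (- c i) * row_form M i \<in> ?I"
      using I.I_l_closed[OF row_in mpoly_ring_closed(1)[of "- c i" n]] by simp
    with insert show ?case using I.a_closed by fastforce
  qed
  ultimately have "(?hs ! k) \<otimes>\<^bsub>?A\<^esub> mpoly_const (c k) \<in> ?I"
    using \<open>k < m\<close> by simp
  then have "mpoly_const (c k) \<in> ?I"
    using regular_sequence_cancel[OF cring_mpoly_ring reg, of k] \<open>k < m\<close> mpoly_ring_closed(1)
    by (metis length_map length_upt minus_nat.diff_0)
  also have "?I \<subseteq> ?N"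
    by (rule A.genideal_minimal[OF ideal_no_constant_term])
      (auto simp: gens closed row_form_no_constant_term)
  finally show ?thesis by (simp add: mpoly_const_def)
qed

text \<open>
  The columns are recorded by a map \<open>q\<close> in the order in which they are found, since the bordering
  step appends the new column at the end.
\<close>

lemma nonzero_bordering_minor:
  fixes M :: "'a::comm_ring_1 mat"
  assumes indep: "\<And>k c. k < m \<Longrightarrow> (\<And>j. j < n \<Longrightarrow> (\<Sum>i\<le>k. c i * M $$ (i, j)) = 0) \<Longrightarrow> c k = 0"
    and "r \<le> m"
  shows "\<exists>q. q ` {..<r} \<subseteq> {..<n} \<and> det (mat r r (\<lambda>(i, k). M $$ (i, q k))) \<noteq> 0"
  using \<open>r \<le> m\<close>
proof (induction r)
  case 0
  show ?case by simp
next
  case (Suc r)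
  then obtain q where q: "q ` {..<r} \<subseteq> {..<n}"
    and det: "det (mat r r (\<lambda>(i, k). M $$ (i, q k))) \<noteq> 0" by auto
  define N where "N j = mat (Suc r) (Suc r) (\<lambda>(i, k). M $$ (i, (q(r := j)) k))" for j
  \<comment> \<open>Deleting the last column makes the choice of \<open>j\<close> irrelevant; \<open>0\<close> is an arbitrary choice.\<close>
  define c where "c i = cofactor (N 0) i r" for i
  have cof: "cofactor (N j) i r = c i" for i j
    unfolding c_def cofactor_def
    by (rule arg_cong[where f = "\<lambda>A. _ * det A"]) (auto simp: N_def mat_delete_def intro!: eq_matI)
  have expand: "det (N j) = (\<Sum>i\<le>r. c i * M $$ (i, j))" for j
  proof -
    have "det (N j) = (\<Sum>i<Suc r. N j $$ (i, r) * cofactor (N j) i r)"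
      by (rule laplace_expansion_column) (auto simp: N_def)
    also have "\<dots> = (\<Sum>i<Suc r. c i * M $$ (i, j))"
      unfolding cof by (intro sum.cong) (auto simp: N_def mult.commute)
    finally show ?thesis by (simp only: lessThan_Suc_atMost)
  qed
  have "c r = det (mat r r (\<lambda>(i, k). M $$ (i, q k)))"
    unfolding c_def cofactor_def
    by (auto simp: N_def mat_delete_def mult_2[symmetric] intro!: arg_cong[where f = det] eq_matI)
  with det have "c r \<noteq> 0" by simp
  then obtain j where "j < n" "det (N j) \<noteq> 0"
    using indep[of r c] Suc.prems expand by force
  then show ?case
    using q by (intro exI[of _ "q(r := j)"]) (auto simp: N_def lessThan_Suc)
qed

lemma bij_betw_pick: "bij_betw (pick J) {..<card J} J" if "finite J"
proof -
  have inj: "inj_on (pick J) {..<card J}"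
    by (rule inj_onI) (metis lessThan_iff linorder_neqE_nat nat_neq_iff pick_mono_le)
  moreover have "pick J ` {..<card J} \<subseteq> J" using pick_in_set_le by auto
  ultimately show ?thesis
    using that by (simp add: bij_betw_def card_image card_subset_eq)
qed

text \<open>
  A submatrix lists its columns in increasing order, whereas \<open>q\<close> may list them in any order. The
  permutation \<open>p\<close> sends \<open>k\<close> to the position of \<open>q k\<close> in the sorted list.
\<close>

lemma det_selected_columns:
  fixes M :: "'a::comm_ring_1 mat"
  assumes M: "M \<in> carrier_mat m n"
    and q: "q ` {..<m} \<subseteq> {..<n}" and inj: "inj_on q {..<m}"
  shows "\<exists>p. p permutes {..<m} \<and>
    det (mat m m (\<lambda>(i, k). M $$ (i, q k))) = signof p * det (submatrix M {..<m} (q ` {..<m}))"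
proof -
  define J where "J = q ` {..<m}"
  have card: "card J = m" and fin: "finite J" and J: "J \<subseteq> {..<n}"
    using q inj by (auto simp: J_def card_image)
  have bij: "bij_betw (pick J) {..<m} J" using bij_betw_pick[OF fin] card by simp
  define p where "p k = (if k < m then the_inv_into {..<m} (pick J) (q k) else k)" for k
  have p_lt: "p k < m" and pick_p: "pick J (p k) = q k" if "k < m" for k
    using bij that the_inv_into_into[of "pick J" "{..<m}" "q k" "{..<m}"]
      f_the_inv_into_f[of "pick J" "{..<m}" "q k"]
    by (auto simp: p_def bij_betw_def J_def)
  have "inj_on p {..<m}"
    by (rule inj_onI) (metis inj inj_onD lessThan_iff pick_p)
  then have "bij_betw p {..<m} {..<m}"
    using p_lt endo_inj_surj[of "{..<m}" p] by (auto simp: bij_betw_def)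
  then have perm: "p permutes {..<m}"
    by (rule bij_imp_permutes) (simp add: p_def)
  have dim: "card {i. i < m \<and> i \<in> {..<m}} = m" "{j. j < n \<and> j \<in> J} = J"
    using J by (auto simp: Collect_conj_eq lessThan_def[symmetric])
  have pick_id: "pick {..<m} i = i" if "i < m" for i
  proof -
    have "{a \<in> {..<m}. a < i} = {..<i}" using that by auto
    then show ?thesis using pick_card_in_set[of i "{..<m}"] that by simp
  qed
  define S where "S = submatrix M {..<m} J"
  have S: "S \<in> carrier_mat m m" and S_index: "i < m \<Longrightarrow> k < m \<Longrightarrow> S $$ (i, k) = M $$ (i, pick J k)" for i k
    using M dim card by (auto simp: S_def submatrix_def pick_id)
  \<comment> \<open>The determinant rule for permutations concerns rows, hence the transpositions.\<close>
  have "det (mat m m (\<lambda>(i, k). M $$ (i, q k))) =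
      det (mat m m (\<lambda>(i, k). S\<^sup>T $$ (p i, k)))\<^sup>T"
    using S S_index p_lt pick_p by (intro arg_cong[where f = det] eq_matI) auto
  also have "\<dots> = det (mat m m (\<lambda>(i, k). S\<^sup>T $$ (p i, k)))"
    by (rule det_transpose[where n = m]) simp
  also have "\<dots> = signof p * det S\<^sup>T"
    by (rule det_permute_rows) (use S perm in \<open>auto simp: atLeast0LessThan\<close>)
  also have "det S\<^sup>T = det S"
    by (rule det_transpose[OF S])
  finally show ?thesis using perm by (auto simp: S_def J_def)
qed

lemma minor_in_fitting_ideal:
  fixes M :: "'a::comm_ring_1 mat"
  assumes "I \<subseteq> {..<dim_row M}" "J \<subseteq> {..<dim_col M}" "card I = k" "card J = k"
  shows "det (submatrix M I J) \<in> fitting_ideal k M"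
proof -
  have "ring (class_ring :: 'a ring)"
    using cring_class_ring by (rule cring.axioms)
  then have "S \<subseteq> Idl\<^bsub>class_ring\<^esub> S" for S :: "'a set"
    by (rule ring.genideal_self) simp
  then show ?thesis
    unfolding fitting_ideal_def by (rule subsetD) (use assms in auto)
qed

theorem proposition1p3:
  fixes M :: "'a::idom mat" and m n :: nat
  assumes "noetherian_ring (class_ring :: 'a ring)"
    and "M \<in> carrier_mat m n"
    and "regular_sequence (mpoly_ring n) (map (row_form M) [0..<m])"
  shows "m \<le> n \<and> fitting_ideal (min m n) M \<noteq> {0}"
proof -
  obtain q where q: "q ` {..<m} \<subseteq> {..<n}"
    and det: "det (mat m m (\<lambda>(i, k). M $$ (i, q k))) \<noteq> 0"
    using nonzero_bordering_minor[of m n M m] rows_independent_if_regular[OF assms(2,3)] by blast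
  have inj: "inj_on q {..<m}"
  proof (rule inj_onI, rule ccontr)
    fix k l assume "k \<in> {..<m}" "l \<in> {..<m}" "q k = q l" "k \<noteq> l"
    then have "det (mat m m (\<lambda>(i, k). M $$ (i, q k))) = 0"
      by (intro det_identical_columns[of _ m k l]) (auto intro!: eq_vecI)
    with det show False ..
  qed
  then have "m \<le> n"
    using card_inj_on_le[OF inj q] by simp
  have "det (submatrix M {..<m} (q ` {..<m})) \<noteq> 0"
    using det_selected_columns[OF assms(2) q inj] det by auto
  moreover have "det (submatrix M {..<m} (q ` {..<m})) \<in> fitting_ideal m M"
    using assms(2) q inj by (intro minor_in_fitting_ideal) (auto simp: card_image)
  ultimately show ?thesis
    using \<open>m \<le> n\<close> by (auto simp: min_absorb1)
qed

end
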